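(* Let $b>\frac23$, $T>50$, and let $\lambda_0\in C^\infty([T,\infty))$ satisfy $\lambda_0(t)>0$ and $$\frac{|\lambda_0^{(k)}(t)|}{\lambda_0(t)}\le\frac{C_k}{t^k\log^b(t)},\qquad k\ge1,\ t\ge T.$$ Let $h\in C^\infty([0,\infty))$ be any function with $h(t)=\frac{\lambda_0''(t)}{\lambda_0(t)}$ for $t\ge2T$, and define $$\widehat{v_{1,1}}(\xi)=\frac{8}{3\pi\xi^2}\int_0^\infty h(t)\sin(t\xi)\,dt,\qquad \xi>0.$$ If $\widehat{v_{1,1}}\in L^2((0,\infty),\xi\,d\xi)$, then the limit $\lim_{x\to\infty}\int_{2T}^x\frac{t\lambda_0''(t)}{\lambda_0(t)}\,dt$ exists and is finite, and $\lambda_0(t)$ converges to a non-zero constant as $t\to\infty$.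
   Context: No further definitions are needed. (The condition $\widehat{v_{1,1}}\in L^2((0,\infty),\xi\,d\xi)$ is the finite-energy condition for the solution $v_1$ of $-\partial_{tt}v_1+\partial_{rr}v_1+\frac1r\partial_rv_1-\frac{4}{r^2}v_1=0$ with $v_1(0)=0$ and initial velocity $v_{1,1}$ whose Hankel transform of order 2 is $\widehat{v_{1,1}}$.) *)

theory Defs
  imports "HOL-Analysis.Analysis"
begin

(* The k-th derivative of f relative to S. At the endpoint of a half-line {a..} it is one-sided, so
   values of f outside S play no role. It is meaningful only where the derivatives exist. *)
primrec nderiv_within :: "real set \<Rightarrow> nat \<Rightarrow> (real \<Rightarrow> real) \<Rightarrow> real \<Rightarrow> real" where
  "nderiv_within S 0 f = f"
| "nderiv_within S (Suc k) f = (\<lambda>x. vector_derivative (nderiv_within S k f) (at x within S))"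

definition smooth_within :: "real set \<Rightarrow> (real \<Rightarrow> real) \<Rightarrow> bool" where
  "smooth_within S f \<longleftrightarrow> (\<forall>k. nderiv_within S k f differentiable_on S)"

definition v11_hat :: "(real \<Rightarrow> real) \<Rightarrow> real \<Rightarrow> real" where
  "v11_hat h \<xi> = 8 / (3 * pi * \<xi>\<^sup>2) * (LBINT t:{0..}. h t * sin (t * \<xi>))"

(* Membership in L^2((0,\<infinity>), \<xi> d\<xi>). *)
definition in_L2_xi :: "(real \<Rightarrow> real) \<Rightarrow> bool" where
  "in_L2_xi f \<longleftrightarrow> set_borel_measurable lebesgue {0<..} f \<and>
     set_integrable lebesgue {0<..} (\<lambda>\<xi>. \<bar>f \<xi>\<bar>\<^sup>2 * \<xi>)"

end

(* Put S(\<xi>) = int_0^\<infinity> h(t) sin(t \<xi>) dt and M(x) = int_0^x t h(t) dt. As t^2 h(t) \<rightarrow> 0, substituting t = x u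
   and dominated convergence give x S(1/x) - M(x) \<rightarrow> 0. The L^2 condition says that F(x) = x S(1/x) is
   square integrable for dx/x, while M, having derivative g(x)/x with g \<rightarrow> 0, is almost constant on
   [X, 2X]; hence M \<rightarrow> 0. With w = lambda0'/lambda0 the Riccati equation w' + w^2 = h yields
   ln lambda0(x) = x w(x) - M(x) + int x w^2 + const, where x w \<rightarrow> 0 and the last integral converges
   because x w^2 = O(1/(x ln^(2b) x)) and 2b > 1. *)

theory Submission
  imports Defs
begin

section \<open>The rescaled sine transform against the truncated first moment\<close>

lemma integrable_indicator_inverse_square:
  "integrable lborel (\<lambda>u::real. indicator {0..1} u + indicator {1..} u * (1 / u^2))"
proof -
  have "(\<lambda>u::real. 1 / u^2) integrable_on {1..}"
    using has_integral_inverse_power_to_inf[of 2 1] by (auto simp: integrable_on_def)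
  then have "set_integrable lebesgue {1..} (\<lambda>u::real. 1 / u^2)"
    by (rule nonnegative_absolutely_integrable_1) auto
  then have "integrable lebesgue (\<lambda>u::real. indicator {1..} u * (1 / u^2))"
    by (simp add: set_integrable_def)
  then have "integrable lborel (\<lambda>u::real. indicator {1..} u * (1 / u^2))"
    by (subst (asm) integrable_completion) auto
  moreover have "integrable lborel (indicator {0..1::real} :: real \<Rightarrow> real)"
    by (intro integrable_real_indicator) auto
  ultimately show ?thesis by (rule Bochner_Integration.integrable_add[rotated])
qed

lemma bounded_if_tendsto_zero_at_top:
  fixes g :: "real \<Rightarrow> real"
  assumes "continuous_on {a..} g" "(g \<longlongrightarrow> 0) at_top"
  obtains B where "B > 0" "\<And>t. t \<ge> a \<Longrightarrow> \<bar>g t\<bar> \<le> B"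
proof -
  have "\<forall>\<^sub>F t in at_top. \<bar>g t\<bar> < 1"
    using order_tendstoD(2)[OF tendsto_rabs_zero[OF assms(2)], of 1] by simp
  then obtain R where R: "\<And>t. t \<ge> R \<Longrightarrow> \<bar>g t\<bar> < 1"
    by (auto simp: eventually_at_top_linorder)
  have "compact (g ` {a..R})"
    by (rule compact_continuous_image) (use continuous_on_subset[OF assms(1)] in auto)
  then obtain K where K: "\<And>t. t \<in> {a..R} \<Longrightarrow> \<bar>g t\<bar> \<le> K"
    using compact_imp_bounded bounded_iff by (metis imageI real_norm_def)
  show ?thesis
  proof
    show "max K 1 > 0" by simp
    show "\<bar>g t\<bar> \<le> max K 1" if "t \<ge> a" for t
      using K[of t] R[of t] that by (cases "t \<le> R") (auto simp: max_def)
  qed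
qed

text \<open>After t = x u the difference is the integral over u > 0 of (x u)^2 h(x u) times (sin u -
  u 1_{u \<le> 1}) / u^2. The first factor is bounded uniformly and tends to 0 as x grows with u
  fixed; the second is integrable, being bounded near 0 and O(1/u^2) at infinity. Cutting off the
  linear term at u = 1 is what produces the moment over [0, x].\<close>

lemma sine_transform_first_moment:
  fixes h :: "real \<Rightarrow> real"
  assumes cont: "continuous_on {0..} h"
    and decay: "((\<lambda>t. t^2 * h t) \<longlongrightarrow> 0) at_top"
  shows "((\<lambda>x. x * (LBINT t:{0..}. h t * sin (t / x)) - integral {0..x} (\<lambda>t. t * h t)) \<longlongrightarrow> 0) at_top"
proof -
  \<comment> \<open>Extension of \<open>h\<close> by zero, since its values on the negative axis are
    arbitrary; the substitution can then be made on the whole line.\<close>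
  define H where "H t = indicator {0..} t * h t" for t :: real
  \<comment> \<open>One majorant for two purposes: up to constants it dominates both
    \<open>H\<close> and the rescaled integrands \<open>f x\<close>. The value 2 at u = 1 is
    harmless.\<close>
  define W where "W u = indicator {0..1} u + indicator {1..} u * (1 / u^2)" for u :: real
  have [measurable]: "H \<in> borel_measurable borel"
    unfolding H_def using borel_measurable_continuous_on_indicator[OF _ cont] by simp
  have intW: "integrable lborel W"
    unfolding W_def by (rule integrable_indicator_inverse_square)
  obtain B where B: "B > 0" "\<And>t. t \<ge> 0 \<Longrightarrow> \<bar>t^2 * h t\<bar> \<le> B"
    by (rule bounded_if_tendsto_zero_at_top[OF _ decay, of 0]) (auto intro!: continuous_intros cont)
  have BH: "\<bar>t^2 * H t\<bar> \<le> B" for t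
    using B by (cases "t \<ge> 0") (auto simp: H_def)
  have "compact (h ` {0..1})"
    by (rule compact_continuous_image) (use continuous_on_subset[OF cont] in auto)
  then obtain K where K: "\<And>t. t \<in> {0..1} \<Longrightarrow> \<bar>h t\<bar> \<le> K"
    using compact_imp_bounded bounded_iff by (metis imageI real_norm_def)
  \<comment> \<open>Integrability of \<open>H\<close> is what allows the sine integral and the
    moment to be separated below. The bound \<open>B\<close> on t^2 h(t) is useless near t = 0, so
    \<open>K\<close> takes over on [0, 1].\<close>
  have intH: "integrable lborel H"
  proof (rule Bochner_Integration.integrable_bound)
    show "integrable lborel (\<lambda>t. (\<bar>K\<bar> + B) * W t)" using intW by simp
    show "AE t in lborel. norm (H t) \<le> norm ((\<bar>K\<bar> + B) * W t)"
    proof (rule AE_I2)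
      fix t :: real
      consider "t < 0" | "0 \<le> t" "t \<le> 1" | "1 < t" by linarith
      then show "norm (H t) \<le> norm ((\<bar>K\<bar> + B) * W t)"
      proof cases
        case 2
        have "\<bar>h t\<bar> \<le> (\<bar>K\<bar> + B) * 1" using K[of t] 2 B by auto
        also have "\<dots> \<le> (\<bar>K\<bar> + B) * W t"
          by (rule mult_left_mono) (use 2 B in \<open>auto simp: W_def indicator_def\<close>)
        finally show ?thesis using 2 by (simp add: H_def)
      next
        case 3
        have "\<bar>h t\<bar> \<le> B / t^2" using B(2)[of t] 3 by (simp add: abs_mult field_simps)
        also have "\<dots> \<le> (\<bar>K\<bar> + B) / t^2" by (rule divide_right_mono) auto
        finally show ?thesis using 3 B(1) by (simp add: H_def W_def abs_mult)
      qed (simp add: H_def)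
    qed
  qed simp
  define f where "f x u = x^2 * H (x * u) * (sin u - u * indicator {..1} u)" for x u :: real
  have "((\<lambda>x. integral\<^sup>L lborel (f x)) \<longlongrightarrow> integral\<^sup>L lborel (\<lambda>u::real. 0::real)) at_top"
  proof (rule integral_dominated_convergence_at_top[where w = "\<lambda>u. B * W u"])
    show "f x \<in> borel_measurable lborel" for x unfolding f_def by measurable
    show "integrable lborel (\<lambda>u. B * W u)" using intW by simp
    have bd: "\<bar>f x u\<bar> \<le> B * W u" if "x > 0" for x u
    proof -
      consider "u < 0" | "u = 0" | "0 < u" "u \<le> 1" | "1 < u" by linarith
      then show ?thesis
      proof cases
        case 1
        then have "x * u < 0" using that by (simp add: mult_pos_neg)
        then show ?thesis using B by (simp add: f_def H_def W_def)
      next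
        case 2 then show ?thesis using B by (simp add: f_def W_def)
      next
        case 3
        \<comment> \<open>The Taylor polynomial of sin of degree below 2 is u itself, so the
          remainder is quadratic and cancels the singularity of 1/u^2 at 0.\<close>
        have "(\<Sum>m<2. sin_coeff m * u ^ m) = u"
          by (simp add: eval_nat_numeral sin_coeff_def)
        then have "\<bar>sin u - u\<bar> \<le> u^2 / 2"
          using Maclaurin_sin_bound[of u 2] by simp
        also have "\<dots> \<le> u^2" by simp
        finally have "\<bar>sin u - u\<bar> \<le> u^2" .
        then have "\<bar>f x u\<bar> \<le> \<bar>x^2 * H (x * u)\<bar> * u^2"
          using 3 by (simp add: f_def abs_mult mult_left_mono)
        also have "\<dots> = \<bar>(x * u)^2 * H (x * u)\<bar>" by (simp add: abs_mult power_mult_distrib)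
        also have "\<dots> \<le> B" by (rule BH)
        also have "\<dots> \<le> B * W u" using 3 B by (auto simp: W_def indicator_def)
        finally show ?thesis .
      next
        case 4
        have "\<bar>f x u\<bar> \<le> \<bar>x^2 * H (x * u)\<bar> * 1"
          unfolding f_def abs_mult[of "x\<^sup>2 * H (x * u)"]
          using 4 by (intro mult_left_mono) auto
        also have "\<dots> = \<bar>(x * u)^2 * H (x * u)\<bar> / u^2"
          using 4 by (simp add: abs_mult power_mult_distrib)
        also have "\<dots> \<le> B / u^2" using BH by (rule divide_right_mono) auto
        also have "\<dots> = B * W u" using 4 by (simp add: W_def)
        finally show ?thesis .
      qed
    qed
    show "\<forall>\<^sub>F x in at_top. AE u in lborel. norm (f x u) \<le> B * W u"
      using eventually_gt_at_top[of 0] by eventually_elim (use bd in auto)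
    show "AE u in lborel. ((\<lambda>x. f x u) \<longlongrightarrow> 0) at_top"
    proof (rule AE_I2)
      fix u :: real
      consider "u < 0" | "u = 0" | "0 < u" by linarith
      then show "((\<lambda>x. f x u) \<longlongrightarrow> 0) at_top"
      proof cases
        case 1
        have "\<forall>\<^sub>F x in at_top. f x u = 0"
          using eventually_gt_at_top[of 0]
          by eventually_elim (use 1 in \<open>auto simp: f_def H_def indicator_def zero_le_mult_iff\<close>)
        then show ?thesis by (rule tendsto_eventually)
      next
        case 2 then show ?thesis by (simp add: f_def)
      next
        case 3
        have lim: "filterlim (\<lambda>x. x * u) at_top at_top"
          by (rule filterlim_at_top_mult_tendsto_pos[OF tendsto_const 3 filterlim_ident])
        have "((\<lambda>x. ((x * u)^2 * h (x * u)) / u^2 * (sin u - u * indicator {..1} u)) \<longlongrightarrow>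
            0 / u^2 * (sin u - u * indicator {..1} u)) at_top"
          using 3 by (intro tendsto_mult tendsto_divide tendsto_const filterlim_compose[OF decay lim]) auto
        moreover have "\<forall>\<^sub>F x in at_top. ((x * u)^2 * h (x * u)) / u^2 * (sin u - u * indicator {..1} u) = f x u"
          using eventually_gt_at_top[of 0]
          by eventually_elim (use 3 in \<open>simp add: f_def H_def power_mult_distrib\<close>)
        ultimately show ?thesis using tendsto_cong by force
      qed
    qed
  qed simp
  moreover have "\<forall>\<^sub>F x in at_top. integral\<^sup>L lborel (f x) =
      x * (LBINT t:{0..}. h t * sin (t / x)) - integral {0..x} (\<lambda>t. t * h t)"
    using eventually_gt_at_top[of 0]
  proof eventually_elim
    fix x :: real assume x: "x > 0"
    have i1: "integrable lborel (\<lambda>t. H t * sin (t / x))"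
      by (rule Bochner_Integration.integrable_bound[OF intH])
         (auto simp: abs_mult intro!: AE_I2 mult_left_le)
    have i2: "set_integrable lborel {0..x} (\<lambda>t. t * h t)"
      by (intro borel_integrable_atLeastAtMost' continuous_intros)
         (use continuous_on_subset[OF cont] in auto)
    \<comment> \<open>Affine substitution with scale x and shift 0; the Jacobian supplies the second
      factor x in the x^2 of \<open>f\<close>.\<close>
    have "integral\<^sup>L lborel (\<lambda>t. x * H t * (sin (t / x) - t / x * indicator {..1} (t / x)))
        = \<bar>x\<bar> *\<^sub>R integral\<^sup>L lborel (\<lambda>u. x * H (0 + x * u) * (sin ((0 + x * u) / x) - (0 + x * u) / x * indicator {..1} ((0 + x * u) / x)))"
      by (rule lborel_integral_real_affine) (use x in auto)
    also have "\<dots> = integral\<^sup>L lborel (f x)"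
      using x by (simp add: f_def[abs_def] power2_eq_square mult.assoc)
    finally have "integral\<^sup>L lborel (f x)
        = integral\<^sup>L lborel (\<lambda>t. x * H t * (sin (t / x) - t / x * indicator {..1} (t / x)))" ..
    also have "\<dots> = integral\<^sup>L lborel (\<lambda>t. x * (H t * sin (t / x)) - indicator {0..x} t *\<^sub>R (t * h t))"
      by (rule Bochner_Integration.integral_cong)
         (use x in \<open>auto simp: H_def indicator_def field_simps\<close>)
    also have "\<dots> = x * integral\<^sup>L lborel (\<lambda>t. H t * sin (t / x)) - (LBINT t:{0..x}. t * h t)"
      using i1 i2 by (simp add: set_integrable_def set_lebesgue_integral_def)
    also have "(LBINT t:{0..x}. t * h t) = integral {0..x} (\<lambda>t. t * h t)"
      by (rule set_borel_integral_eq_integral[OF i2])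
    finally show "integral\<^sup>L lborel (f x) =
      x * (LBINT t:{0..}. h t * sin (t / x)) - integral {0..x} (\<lambda>t. t * h t)"
      by (simp add: H_def set_lebesgue_integral_def mult.assoc)
  qed
  ultimately show ?thesis by (simp add: tendsto_cong)
qed

section \<open>Vanishing of the first moment under the L^2 condition\<close>

lemma has_real_derivative_first_moment:
  fixes h :: "real \<Rightarrow> real"
  assumes "continuous_on {0..} h" "x > 0"
  shows "((\<lambda>x. integral {0..x} (\<lambda>t. t * h t)) has_real_derivative x * h x) (at x)"
proof -
  \<comment> \<open>Reaching past x makes x an interior point, so the one-sided derivative becomes a
    two-sided one.\<close>
  have "continuous_on {0..x+1} (\<lambda>t. t * h t)"
    by (intro continuous_intros continuous_on_subset[OF assms(1)]) auto
  from integral_has_real_derivative[OF this, of x] assms(2)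
  have "((\<lambda>x. integral {0..x} (\<lambda>t. t * h t)) has_real_derivative x * h x) (at x within {0..x+1})"
    by simp
  moreover have "at x within {0..x+1} = at x"
    using assms(2) by (intro at_within_interior) auto
  ultimately show ?thesis by simp
qed

text \<open>Dominated convergence with majorant |q| on the positive axis: each fixed point leaves
  the interval once X is large. It will show that the L^2 mass at low frequencies becomes
  negligible.\<close>

lemma tendsto_set_integral_shrink:
  fixes q :: "real \<Rightarrow> real"
  assumes "set_integrable lebesgue {0<..} q"
  shows "((\<lambda>X. set_lebesgue_integral lebesgue {0<..1/X} q) \<longlongrightarrow> 0) at_top"
proof -
  have int: "integrable lebesgue (\<lambda>x. indicator {0<..} x *\<^sub>R q x)"
    using assms by (simp add: set_integrable_def)
  have "((\<lambda>X. integral\<^sup>L lebesgue (\<lambda>x. indicator {..1/X} x *\<^sub>R (indicator {0<..} x *\<^sub>R q x))) \<longlongrightarrow>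
      integral\<^sup>L lebesgue (\<lambda>x::real. 0::real)) at_top"
  proof (rule integral_dominated_convergence_at_top[where w = "\<lambda>x. norm (indicator {0<..} x *\<^sub>R q x)"])
    show "integrable lebesgue (\<lambda>x. norm (indicator {0<..} x *\<^sub>R q x))"
      using int by (rule integrable_norm)
    show "(\<lambda>x. indicator {..1/X} x *\<^sub>R (indicator {0<..} x *\<^sub>R q x)) \<in> borel_measurable lebesgue" for X
      by (intro borel_measurable_scaleR borel_measurable_integrable[OF int] borel_measurable_indicator) auto
    show "AE x in lebesgue. ((\<lambda>X. indicator {..1/X} x *\<^sub>R (indicator {0<..} x *\<^sub>R q x)) \<longlongrightarrow> 0) at_top"
    proof (rule AE_I2, rule tendsto_eventually)
      fix x :: real
      show "\<forall>\<^sub>F X in at_top. indicator {..1/X} x *\<^sub>R (indicator {0<..} x *\<^sub>R q x) = 0"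
        using eventually_gt_at_top[of "max 0 (1/x)"]
        by eventually_elim (auto simp: indicator_def field_simps)
    qed
  qed (auto simp: indicator_def)
  moreover have "(\<lambda>x. indicator {..1/X} x *\<^sub>R (indicator {0<..} x *\<^sub>R q x)) = (\<lambda>x. indicator {0<..1/X} x *\<^sub>R q x)" for X
    by (auto simp: indicator_def)
  ultimately show ?thesis unfolding set_lebesgue_integral_def by simp
qed

text \<open>By contradiction: if |M(X)| \<ge> e for a large X, then |F| \<ge> e/2 on all of [X, 2X],
  because M varies little there and F is close to M. In the frequency \<xi> = 1/x this is the
  interval [1/(2X), 1/X], which then carries an L^2 mass of at least \<delta>, independent of X. The
  mass on (0, 1/X] tends to 0, so this fails for large X.\<close>

lemma first_moment_tendsto_zero:
  fixes h :: "real \<Rightarrow> real"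
  assumes cont: "continuous_on {0..} h"
    and decay: "((\<lambda>t. t^2 * h t) \<longlongrightarrow> 0) at_top"
    and L2: "in_L2_xi (v11_hat h)"
  shows "((\<lambda>x. integral {0..x} (\<lambda>t. t * h t)) \<longlongrightarrow> 0) at_top"
proof (rule tendstoI)
  fix e :: real assume e: "e > 0"
  define M where "M x = integral {0..x} (\<lambda>t. t * h t)" for x
  define F where "F x = x * (LBINT t:{0..}. h t * sin (t / x))" for x
  define q where "q = (\<lambda>\<xi>. \<bar>v11_hat h \<xi>\<bar>\<^sup>2 * \<xi>)"
  \<comment> \<open>The lower bound \<open>c\<close> for \<open>q\<close> on [1/(2X), 1/X] times the
    length 1/(2X) of that interval; the factor X in \<open>c\<close> cancels.\<close>
  define \<delta> where "\<delta> = (8 / (3 * pi))^2 * (e / 2)^2 / 2"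
  have "\<delta> > 0" using e by (simp add: \<delta>_def)
  have intq: "set_integrable lebesgue {0<..} q" using L2 by (simp add: in_L2_xi_def q_def)
  \<comment> \<open>The substitution \<xi> = 1/x thus turns q(\<xi>) d\<xi> into a constant times
    F(x)^2 dx/x.\<close>
  have q_eq: "q \<xi> = (8 / (3 * pi))^2 * (F (1 / \<xi>))^2 / \<xi>" if "\<xi> > 0" for \<xi>
    using that by (simp add: q_def v11_hat_def F_def power_mult_distrib power_divide power2_eq_square field_simps)
  \<comment> \<open>Two errors of e/4, one from F - M and one from the variation of M, leave e/2 out
    of e.\<close>
  have "\<forall>\<^sub>F x in at_top. \<bar>F x - M x\<bar> < e / 4"
    using tendstoD[OF sine_transform_first_moment[OF cont decay], of "e/4"] e
    by (simp add: F_def M_def)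
  then obtain R1 where R1: "\<And>x. x \<ge> R1 \<Longrightarrow> \<bar>F x - M x\<bar> < e / 4"
    by (auto simp: eventually_at_top_linorder)
  have "\<forall>\<^sub>F t in at_top. \<bar>t^2 * h t\<bar> < e / 4"
    using tendstoD[OF decay, of "e/4"] e by simp
  then obtain R2 where R2: "\<And>t. t \<ge> R2 \<Longrightarrow> \<bar>t^2 * h t\<bar> < e / 4"
    by (auto simp: eventually_at_top_linorder)
  have "\<forall>\<^sub>F X in at_top. set_lebesgue_integral lebesgue {0<..1/X} q < \<delta>"
    using order_tendstoD(2)[OF tendsto_set_integral_shrink[OF intq] \<open>\<delta> > 0\<close>] .
  then show "\<forall>\<^sub>F X in at_top. dist (integral {0..X} (\<lambda>t. t * h t)) 0 < e"
    using eventually_ge_at_top[of "max R1 R2"] eventually_gt_at_top[of 0]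
  proof eventually_elim
    fix X :: real
    assume small: "set_lebesgue_integral lebesgue {0<..1/X} q < \<delta>" and XR: "max R1 R2 \<le> X" and X: "0 < X"
    show "dist (integral {0..X} (\<lambda>t. t * h t)) 0 < e"
    proof (rule ccontr)
      assume "\<not> ?thesis"
      then have big: "\<bar>M X\<bar> \<ge> e" by (simp add: M_def)
      have Fbig: "\<bar>F y\<bar> \<ge> e / 2" if y: "X \<le> y" "y \<le> 2 * X" for y
      proof -
        have "\<bar>M y - M X\<bar> \<le> e / 4"
        proof (cases "X = y")
          case False
          with y have "X < y" by simp
          from MVT2[OF this, of M "\<lambda>t. t * h t"]
          obtain z where z: "X < z" "z < y" "M y - M X = (y - X) * (z * h z)"
            using has_real_derivative_first_moment[OF cont] X unfolding M_def by force
          have "\<bar>M y - M X\<bar> = (y - X) * \<bar>z * h z\<bar>" using z(3) y by (simp add: abs_mult)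
          \<comment> \<open>Here y - X \<le> X < z, since y stays within the dyadic interval; this
            restores the factor z^2 that the decay hypothesis controls.\<close>
          also have "\<dots> \<le> z * \<bar>z * h z\<bar>" using y z by (intro mult_right_mono) auto
          also have "\<dots> = \<bar>z^2 * h z\<bar>" using z X by (simp add: abs_mult power2_eq_square)
          also have "\<dots> \<le> e / 4" using R2[of z] z XR by simp
          finally show ?thesis .
        qed (use e in simp)
        moreover have "\<bar>F y - M y\<bar> < e / 4" using R1 XR y by auto
        ultimately show ?thesis using big by linarith
      qed
      define c where "c = (8 / (3 * pi))^2 * (e / 2)^2 * X"
      have qc: "q \<xi> \<ge> c" if \<xi>: "\<xi> \<in> {1/(2*X)..1/X}" for \<xi>
      proof -
        have pos: "\<xi> > 0" using \<xi> X by (auto intro: less_le_trans[rotated])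
        have "X \<le> 1/\<xi>" "1/\<xi> \<le> 2 * X" using \<xi> pos X by (auto simp: field_simps)
        from Fbig[OF this] have "(e / 2)^2 \<le> (F (1/\<xi>))^2"
          using e by (metis abs_le_square_iff abs_of_pos half_gt_zero)
        moreover have "X \<le> 1 / \<xi>" by fact
        ultimately have "(e / 2)^2 * X \<le> (F (1/\<xi>))^2 * (1 / \<xi>)"
          using X by (intro mult_mono) auto
        then have "(8 / (3 * pi))^2 * ((e / 2)^2 * X) \<le> (8 / (3 * pi))^2 * ((F (1/\<xi>))^2 * (1 / \<xi>))"
          by (rule mult_left_mono) simp
        then show ?thesis using q_eq[OF pos] by (simp add: c_def mult.assoc)
      qed
      have "\<delta> = c * measure lebesgue {1/(2*X)..1/X}"
        using X by (simp add: \<delta>_def c_def field_simps)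
      also have "\<dots> = integral\<^sup>L lebesgue (\<lambda>x. c * indicator {1/(2*X)..1/X} x)"
        by simp
      \<comment> \<open>As \<open>q\<close> is nonnegative on the positive axis, discarding (0,
        1/(2X)) only lowers the integral.\<close>
      also have "\<dots> \<le> set_lebesgue_integral lebesgue {0<..1/X} q"
        unfolding set_lebesgue_integral_def
      proof (rule integral_mono)
        show "integrable lebesgue (\<lambda>x. c * indicator {1/(2*X)..1/X} x)"
          by (intro integrable_mult_right integrable_real_indicator) (auto simp: emeasure_lborel_Icc_eq)
        show "integrable lebesgue (\<lambda>x. indicator {0<..1/X} x *\<^sub>R q x)"
          using set_integrable_subset[OF intq, of "{0<..1/X}"] by (simp add: set_integrable_def subset_iff)
        fix x :: real
        have "0 \<le> q x" if "x > 0" using that by (simp add: q_def)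
        moreover have "0 < x" if "x \<in> {1/(2*X)..1/X}"
          using that X by (auto intro: less_le_trans[rotated])
        ultimately show "c * indicator {1/(2*X)..1/X} x \<le> indicator {0<..1/X} x *\<^sub>R q x"
          using qc[of x] by (auto simp: indicator_def)
      qed
      finally show False using small by simp
    qed
  qed
qed

section \<open>The Riccati equation and the limit of \<open>lambda0\<close>\<close>

lemma antimono_bounded_tendsto_at_top:
  fixes P :: "real \<Rightarrow> real"
  assumes mono: "\<And>x y. a \<le> x \<Longrightarrow> x \<le> y \<Longrightarrow> P y \<le> P x" and bdd: "\<And>x. a \<le> x \<Longrightarrow> B \<le> P x"
  obtains L where "(P \<longlongrightarrow> L) at_top"
proof
  define L where "L = (INF x\<in>{a..}. P x)"
  have bb: "bdd_below (P ` {a..})" using bdd by (auto intro!: bdd_belowI)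
  show "(P \<longlongrightarrow> L) at_top"
  proof (rule decreasing_tendsto)
    show "\<forall>\<^sub>F x in at_top. L \<le> P x"
      using eventually_ge_at_top[of a] by eventually_elim (auto simp: L_def intro!: cINF_lower bb)
    fix y assume "L < y"
    then obtain x0 where "x0 \<ge> a" "P x0 < y"
      unfolding L_def by (subst (asm) cINF_less_iff) (use bb in auto)
    then have "P x < y" if "x \<ge> x0" for x
      using mono[of x0 x] that by simp
    then show "\<forall>\<^sub>F x in at_top. P x < y"
      by (rule eventually_at_top_linorderI)
  qed
qed

theorem mainTheorem4:
  fixes b T :: real and lambda0 h :: "real \<Rightarrow> real" and C :: "nat \<Rightarrow> real"
  assumes b: "b > 2 / 3"
    and T: "T > 50"
    and smooth: "smooth_within {T..} lambda0"
    and pos: "\<And>t. t \<ge> T \<Longrightarrow> lambda0 t > 0"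
    and bound: "\<And>k t. k \<ge> 1 \<Longrightarrow> t \<ge> T \<Longrightarrow>
      \<bar>nderiv_within {T..} k lambda0 t\<bar> / lambda0 t \<le> C k / (t ^ k * ln t powr b)"
    and h_smooth: "smooth_within {0..} h"
    and h_eq: "\<And>t. t \<ge> 2 * T \<Longrightarrow> h t = nderiv_within {T..} 2 lambda0 t / lambda0 t"
    and L2: "in_L2_xi (v11_hat h)"
  shows "(\<exists>L::real. ((\<lambda>x. LBINT t:{2 * T..x}. t * nderiv_within {T..} 2 lambda0 t / lambda0 t) \<longlongrightarrow> L) at_top)
    \<and> (\<exists>c::real. c \<noteq> 0 \<and> (lambda0 \<longlongrightarrow> c) at_top)"
proof -
  define d where "d k = nderiv_within {T..} k lambda0" for k
  \<comment> \<open>Beyond the endpoint T the derivatives relative to the half-line are ordinary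
    two-sided ones.\<close>
  have deriv: "(d k has_real_derivative d (Suc k) t) (at t)" if t: "t > T" for k t
  proof -
    have "d k differentiable (at t within {T..})"
      using smooth t by (auto simp: smooth_within_def d_def differentiable_on_def)
    then have "(d k has_vector_derivative d (Suc k) t) (at t within {T..})"
      by (simp add: d_def vector_derivative_works)
    moreover have "at t within {T..} = at t" using t by (intro at_within_interior) auto
    ultimately show ?thesis by (simp add: has_real_derivative_iff_has_vector_derivative)
  qed
  have d0: "d 0 = lambda0" by (simp add: d_def)
  have log_pos: "ln t > 0" if "t \<ge> T" for t using that T by (intro ln_gt_zero) auto
  have ratio: "\<bar>t ^ k * (d k t / lambda0 t)\<bar> \<le> C k / ln t powr b" if "t \<ge> T" "k \<ge> 1" for t k
  proof -
    have "t > 0" using that T by simp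
    have "\<bar>t ^ k * (d k t / lambda0 t)\<bar> = t ^ k * (\<bar>d k t\<bar> / lambda0 t)"
      using pos[OF that(1)] \<open>t > 0\<close> by (simp add: abs_mult power_abs)
    also have "\<dots> \<le> t ^ k * (C k / (t ^ k * ln t powr b))"
      unfolding d_def by (rule mult_left_mono[OF bound]) (use that \<open>t > 0\<close> in auto)
    also have "\<dots> = C k / ln t powr b" using \<open>t > 0\<close> by simp
    finally show ?thesis .
  qed
  have log_lim: "((\<lambda>t. K / ln t powr b) \<longlongrightarrow> 0) at_top" for K
  proof -
    have "((\<lambda>t. ln t powr - b) \<longlongrightarrow> 0) at_top"
      by (rule tendsto_neg_powr[OF _ ln_at_top]) (use b in auto)
    from tendsto_mult[OF tendsto_const[of K] this] show ?thesis
      by (simp add: powr_minus divide_inverse)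
  qed
  \<comment> \<open>Used twice: k = 2 gives the decay of t^2 h(t), and k = 1 gives x w(x)
    \<rightarrow> 0.\<close>
  have ratio_lim: "((\<lambda>t. t ^ k * (d k t / lambda0 t)) \<longlongrightarrow> 0) at_top" if "k \<ge> 1" for k
  proof (rule Lim_null_comparison[OF _ log_lim[of "C k"]])
    show "\<forall>\<^sub>F t in at_top. norm (t ^ k * (d k t / lambda0 t)) \<le> C k / ln t powr b"
      by (rule eventually_at_top_linorderI[of T]) (simp only: real_norm_def ratio that)
  qed
  have cont_h: "continuous_on {0..} h"
    using h_smooth unfolding smooth_within_def
    by (metis differentiable_imp_continuous_on nderiv_within.simps(1))
  have h_eq': "h t = d 2 t / lambda0 t" if "t \<ge> 2 * T" for t
    using h_eq[OF that] by (simp add: d_def)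
  have decay: "((\<lambda>t. t^2 * h t) \<longlongrightarrow> 0) at_top"
  proof (rule Lim_transform_eventually[OF ratio_lim[of 2]])
    show "\<forall>\<^sub>F t in at_top. t\<^sup>2 * (d 2 t / lambda0 t) = t\<^sup>2 * h t"
      using eventually_ge_at_top[of "2 * T"] by eventually_elim (simp add: h_eq')
  qed simp
  define M where "M x = integral {0..x} (\<lambda>t. t * h t)" for x
  have M_lim: "(M \<longlongrightarrow> 0) at_top"
    unfolding M_def by (rule first_moment_tendsto_zero[OF cont_h decay L2])
  have M_deriv: "(M has_real_derivative x * h x) (at x)" if "x > 0" for x
    unfolding M_def by (rule has_real_derivative_first_moment[OF cont_h that])
  \<comment> \<open>\<open>h\<close> is prescribed only from 2T on; its arbitrary part on [0, 2T]
    enters through the constant M(2T) alone, so the integral converges to -M(2T).\<close>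
  have M_eq: "\<forall>\<^sub>F x in at_top. M x - M (2 * T) = (LBINT t:{2 * T..x}. t * nderiv_within {T..} 2 lambda0 t / lambda0 t)"
    using eventually_ge_at_top[of "2 * T"]
  proof eventually_elim
    fix x assume x: "2 * T \<le> x"
    have int: "(\<lambda>t. t * h t) integrable_on {0..x}"
      by (intro integrable_continuous_real continuous_intros continuous_on_subset[OF cont_h]) auto
    have int': "set_integrable lborel {2 * T..x} (\<lambda>t. t * h t)"
      by (intro borel_integrable_atLeastAtMost' continuous_intros continuous_on_subset[OF cont_h])
         (use T in auto)
    have "M x - M (2 * T) = integral {2 * T..x} (\<lambda>t. t * h t)"
      using Henstock_Kurzweil_Integration.integral_combine[OF _ x int] T by (simp add: M_def)
    also have "\<dots> = (LBINT t:{2 * T..x}. t * h t)"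
      by (rule set_borel_integral_eq_integral(2)[OF int', symmetric])
    also have "\<dots> = (LBINT t:{2 * T..x}. t * nderiv_within {T..} 2 lambda0 t / lambda0 t)"
      by (rule set_lebesgue_integral_cong) (auto simp: h_eq)
    finally show "M x - M (2 * T) = (LBINT t:{2 * T..x}. t * nderiv_within {T..} 2 lambda0 t / lambda0 t)" .
  qed
  have "((\<lambda>x. M x - M (2 * T)) \<longlongrightarrow> 0 - M (2 * T)) at_top"
    by (intro tendsto_intros M_lim)
  from Lim_transform_eventually[OF this M_eq] have first: "\<exists>L::real. ((\<lambda>x. LBINT t:{2 * T..x}. t * nderiv_within {T..} 2 lambda0 t / lambda0 t) \<longlongrightarrow> L) at_top"
    by (rule exI)

  define w where "w t = d 1 t / lambda0 t" for t
  \<comment> \<open>Chosen so that only the quadratic Riccati term survives: with w' = h - w^2, the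
    derivative of x w is w + x h - x w^2, and the other two terms remove w and x h. Hence
    \<open>P\<close> is nonincreasing and it remains to bound it below.\<close>
  define P where "P x = x * w x - ln (lambda0 x) - M x" for x
  have P_deriv: "(P has_real_derivative - x * (w x)^2) (at x)" if x: "x \<ge> 2 * T" for x
  proof -
    have xT: "x > T" "x > 0" using x T by auto
    have l: "lambda0 x > 0" using pos xT by simp
    have D0: "(lambda0 has_real_derivative d 1 x) (at x)" using deriv[OF xT(1), of 0] by (simp add: d0)
    have D1: "(d 1 has_real_derivative d 2 x) (at x)"
      using deriv[OF xT(1), of 1] by (simp add: numeral_2_eq_2)
    have "(w has_real_derivative h x - (w x)^2) (at x)"
      unfolding w_def
      by (rule DERIV_cong[OF DERIV_divide[OF D1 D0]])
         (use l in \<open>simp_all add: h_eq'[OF x] divide_simps power2_eq_square\<close>)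
    from DERIV_mult[OF DERIV_ident this]
    have Dxw: "((\<lambda>x. x * w x) has_real_derivative w x + x * (h x - (w x)^2)) (at x)"
      by (rule DERIV_cong) simp
    have Dln: "((\<lambda>x. ln (lambda0 x)) has_real_derivative w x) (at x)"
      by (rule DERIV_cong[OF DERIV_chain2[OF DERIV_ln[OF l] D0]]) (simp add: w_def divide_inverse)
    show ?thesis
      unfolding P_def
      by (rule DERIV_cong[OF DERIV_diff[OF DERIV_diff[OF Dxw Dln] M_deriv[OF xT(2)]]])
         (simp add: algebra_simps)
  qed
  \<comment> \<open>The tail integral of (C 1)^2 / (s ln^(2b) s) from x to infinity, finite because
    2b > 1. Its integrand dominates x w^2, so P - Q is nondecreasing; as Q \<ge> 0, this bounds
    \<open>P\<close> from below.\<close>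
  define Q where "Q x = (C 1)^2 / (2 * b - 1) * ln x powr (1 - 2 * b)" for x
  have Q_deriv: "(Q has_real_derivative - ((C 1)^2 * ln x powr (- 2 * b) / x)) (at x)" if x: "x \<ge> 2 * T" for x
  proof -
    have "x > 0" "ln x > 0" using x T log_pos[of x] by auto
    have "((\<lambda>x. ln x powr (1 - 2 * b)) has_real_derivative
        (1 - 2 * b) * ln x powr (1 - 2 * b - 1) * (1 / x)) (at x)"
      by (rule DERIV_chain2[OF has_real_derivative_powr[OF \<open>ln x > 0\<close>] DERIV_ln_divide[OF \<open>x > 0\<close>]])
    from DERIV_cmult[OF this, of "(C 1)^2 / (2 * b - 1)"] show ?thesis
      unfolding Q_def
      by (rule DERIV_cong) (use b \<open>x > 0\<close> in \<open>simp add: divide_simps, simp add: algebra_simps\<close>)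
  qed
  obtain l where P_lim: "(P \<longlongrightarrow> l) at_top"
  proof (rule antimono_bounded_tendsto_at_top)
    show "P y \<le> P x" if "2 * T \<le> x" "x \<le> y" for x y
    proof (rule DERIV_nonpos_imp_nonincreasing[OF that(2)])
      fix z assume "x \<le> z" "z \<le> y"
      then show "\<exists>y. (P has_real_derivative y) (at z) \<and> y \<le> 0"
        using that(1) T by (intro exI[of _ "- z * (w z)^2"] conjI P_deriv) auto
    qed
    show "P (2 * T) - Q (2 * T) \<le> P x" if x: "2 * T \<le> x" for x
    proof -
      have "P (2 * T) - Q (2 * T) \<le> P x - Q x"
      proof (rule DERIV_nonneg_imp_nondecreasing[OF x])
        fix y assume y: "2 * T \<le> y" "y \<le> x"
        then have y0: "y > 0" and yT: "y \<ge> T" using T by auto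
        \<comment> \<open>Squaring the first-derivative bound and dividing by y gives the majorant
          of y w^2 = (y w)^2 / y whose tail integral is \<open>Q\<close>.\<close>
        have "\<bar>y * w y\<bar> \<le> C 1 / ln y powr b" using ratio[OF yT, of 1] by (simp add: w_def)
        then have "\<bar>y * w y\<bar>^2 \<le> (C 1 / ln y powr b)^2" by (rule power_mono) simp
        also have "(C 1 / ln y powr b)^2 = (C 1)^2 * ln y powr (- 2 * b)"
          using log_pos[OF yT] by (simp add: power_divide powr_minus powr_power field_simps)
        finally have "y * (w y)^2 \<le> (C 1)^2 * ln y powr (- 2 * b) / y"
          using y0 by (simp add: power2_eq_square field_simps)
        then show "\<exists>z. ((\<lambda>x. P x - Q x) has_real_derivative z) (at y) \<and> z \<ge> 0"
          using DERIV_diff[OF P_deriv[OF y(1)] Q_deriv[OF y(1)]] by (intro exI conjI) auto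
      qed
      also have "\<dots> \<le> P x" using b by (simp add: Q_def)
      finally show ?thesis .
    qed
  qed
  \<comment> \<open>Solving the definition of \<open>P\<close> for ln lambda0 and exponentiating
    yields the limit exp(-l), which is automatically non-zero.\<close>
  have "((\<lambda>x. exp (x * w x - M x - P x)) \<longlongrightarrow> exp (0 - 0 - l)) at_top"
    using ratio_lim[of 1] by (intro tendsto_intros M_lim P_lim) (simp add: w_def)
  moreover have "\<forall>\<^sub>F x in at_top. exp (x * w x - M x - P x) = lambda0 x"
    using eventually_ge_at_top[of T] by eventually_elim (simp add: P_def pos)
  ultimately have "(lambda0 \<longlongrightarrow> exp (0 - 0 - l)) at_top"
    by (rule Lim_transform_eventually)
  then have "\<exists>c::real. c \<noteq> 0 \<and> (lambda0 \<longlongrightarrow> c) at_top"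
    by (intro exI[of _ "exp (0 - 0 - l)"] conjI) simp_all
  with first show ?thesis by (rule conjI)
qed

end
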